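(* Let $G=(V,E)$ be a finite graph (loops and multiple edges allowed) and let $e\in E$ be an edge that is not a loop. Then, in $\mathbb{Z}[\beta,\gamma]$, $$\theta_{G}(\beta,\gamma)=(1-\beta)\,\theta_{G\backslash e}(\beta,\gamma)+\beta\,\theta_{G/e}(\beta,\gamma).$$
   Context: Graphs are finite undirected multigraphs; loops and multiple edges are allowed. The degree of a vertex is the number of edge-ends at it (a loop counts twice). A subset $s\subset E$ is identified with the spanning subgraph $(V,s)$, and $d_i(s)$ is the degree of vertex $i$ in $(V,s)$. $G\backslash e$ is $G$ with $e$ deleted; $G/e$ is $G$ with $e$ contracted (the endpoints are merged, $e$ is removed, and any edges parallel to $e$ become loops). The polynomials $f_n(x)$, $n\ge 0$, are defined by $f_0(x)=1$, $f_1(x)=0$, $f_{n+1}(x)=x f_n(x)+f_{n-1}(x)$ for $n\ge1$. The graph polynomial $\theta_G$ is $$\theta_G(\beta,\gamma):=\sum_{s\subset E}\beta^{|s|}\prod_{i\in V}f_{d_i(s)}(\gamma)\in\mathbb{Z}[\beta,\gamma].$$ *)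

theory Defs
  imports Main "HOL-Library.Multiset" "HOL-Computational_Algebra.Polynomial"
begin

text \<open>
  The two ends of an edge form a multiset of size 2, so that parallel edges are distinct
  edges with the same ends, and a loop at \<open>v\<close> has ends \<open>{#v, v#}\<close>.
\<close>

record ('v, 'e) multigraph =
  verts :: "'v set"
  edges :: "'e set"
  ends :: "'e \<Rightarrow> 'v multiset"

locale finite_multigraph =
  fixes G :: "('v, 'e) multigraph"
  assumes finite_verts: "finite (verts G)"
    and finite_edges: "finite (edges G)"
    and size_ends: "a \<in> edges G \<Longrightarrow> size (ends G a) = 2"
    and ends_in_verts: "a \<in> edges G \<Longrightarrow> set_mset (ends G a) \<subseteq> verts G"

definition is_loop :: "('v, 'e) multigraph \<Rightarrow> 'e \<Rightarrow> bool" where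
  "is_loop G e \<longleftrightarrow> (\<exists>v. ends G e = {#v, v#})"

definition vertex_degree :: "('v, 'e) multigraph \<Rightarrow> 'v \<Rightarrow> nat" where
  "vertex_degree G i = (\<Sum>a\<in>edges G. count (ends G a) i)"

definition spanning_subgraph :: "('v, 'e) multigraph \<Rightarrow> 'e set \<Rightarrow> ('v, 'e) multigraph" where
  "spanning_subgraph G s = G\<lparr>edges := s\<rparr>"

definition delete_edge :: "('v, 'e) multigraph \<Rightarrow> 'e \<Rightarrow> ('v, 'e) multigraph" where
  "delete_edge G e = spanning_subgraph G (edges G - {e})"

text \<open>
  The vertices of the contraction are the classes of the equivalence relation on the old
  vertices that identifies the ends of \<open>e\<close>; hence its vertex type is \<open>'v set\<close>.
\<close>

definition merge_class :: "('v, 'e) multigraph \<Rightarrow> 'e \<Rightarrow> 'v \<Rightarrow> 'v set" where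
  "merge_class G e v = (if v \<in># ends G e then set_mset (ends G e) else {v})"

definition contract_edge :: "('v, 'e) multigraph \<Rightarrow> 'e \<Rightarrow> ('v set, 'e) multigraph" where
  "contract_edge G e =
     \<lparr>verts = merge_class G e ` verts G,
      edges = edges G - {e},
      ends = (\<lambda>a. image_mset (merge_class G e) (ends G a))\<rparr>"

fun f_poly :: "nat \<Rightarrow> int poly" where
  "f_poly 0 = 1"
| "f_poly (Suc 0) = 0"
| "f_poly (Suc (Suc n)) = [:0, 1:] * f_poly (Suc n) + f_poly n"

text \<open>
  The ring \<open>\<int>[\<beta>, \<gamma>]\<close> is taken as \<open>\<int>[\<gamma>][\<beta>]\<close>: the outer indeterminate of
  \<open>int poly poly\<close> is \<open>\<beta>\<close>, the inner one is \<open>\<gamma>\<close>. Thus \<open>f\<^sub>n(\<gamma>)\<close> is the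
  constant polynomial (in \<open>\<beta>\<close>) with coefficient \<open>f_poly n\<close>.
\<close>

definition beta :: "int poly poly" where
  "beta = [:0, 1:]"

definition theta :: "('v, 'e) multigraph \<Rightarrow> int poly poly" where
  "theta G = (\<Sum>s\<in>Pow (edges G).
     beta ^ card s * (\<Prod>i\<in>verts G. [:f_poly (vertex_degree (spanning_subgraph G s) i):]))"

end

theory Submission
  imports Defs
begin

text \<open>
  Pair each subset \<open>s\<close> of the edges other than \<open>e\<close> with \<open>insert e s\<close>. If \<open>u \<noteq> v\<close> are the
  ends of \<open>e\<close>, of degrees \<open>m\<close> and \<open>n\<close> in \<open>s\<close>, then the two terms of \<open>theta G\<close> share the
  power \<open>beta ^ card s\<close> and the factors of all other vertices, and what remains is
  \<open>f\<^sub>m f\<^sub>n + \<beta> f\<^sub>m\<^sub>+\<^sub>1 f\<^sub>n\<^sub>+\<^sub>1\<close>, because \<open>e\<close> raises both degrees by one. In the contraction the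
  merged vertex has degree \<open>m + n\<close>. The addition law
  \<open>f\<^sub>m\<^sub>+\<^sub>n = f\<^sub>m f\<^sub>n + f\<^sub>m\<^sub>+\<^sub>1 f\<^sub>n\<^sub>+\<^sub>1\<close> (\<open>f_poly_add\<close>) turns the remainder into
  \<open>(1 - \<beta>) f\<^sub>m f\<^sub>n + \<beta> f\<^sub>m\<^sub>+\<^sub>n\<close>: the terms of \<open>s\<close> in the deletion and in the contraction.
  The recurrence is therefore true for each \<open>s\<close> separately
  (\<open>edge_pair_weights\<close>), and \<open>theorem1\<close> is the sum over \<open>s\<close>.
\<close>

text \<open>
  Both sides satisfy the recurrence of \<open>f_poly\<close> in \<open>m\<close>. They agree at \<open>m = 0\<close> and
  \<open>m = 1\<close> since \<open>f\<^sub>0 = f\<^sub>2 = 1\<close> and \<open>f\<^sub>1 = 0\<close>.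
\<close>

lemma f_poly_add:
  "f_poly (m + n) = f_poly m * f_poly n + f_poly (Suc m) * f_poly (Suc n)"
proof (induction m rule: f_poly.induct)
  case (3 m)
  then show ?case
    by (simp add: algebra_simps)
qed simp_all

lemma count_image_mset_pair:
  assumes "u \<noteq> v" and "\<And>x. f x = y \<longleftrightarrow> x = u \<or> x = v"
  shows "count (image_mset f A) y = count A u + count A v"
  by (induction A) (use assms in auto)

lemma count_image_mset_singleton:
  assumes "\<And>x. f x = y \<longleftrightarrow> x = w"
  shows "count (image_mset f A) y = count A w"
  by (induction A) (use assms in auto)

lemma ends_of_nonloop:
  assumes "finite_multigraph G" "e \<in> edges G" "\<not> is_loop G e"
  obtains u v where "ends G e = {#u, v#}" "u \<noteq> v" "u \<in> verts G" "v \<in> verts G"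
proof -
  have size: "size (ends G e) = Suc 1"
    using finite_multigraph.size_ends[OF assms(1,2)] by simp
  then obtain u N where uN: "ends G e = add_mset u N"
    using size_eq_Suc_imp_eq_union by blast
  with size have "size N = 1"
    by simp
  then obtain v where "N = {#v#}"
    using size_1_singleton_mset by blast
  with uN have uv: "ends G e = {#u, v#}"
    by simp
  have "u \<noteq> v"
    using assms(3) uv unfolding is_loop_def by auto
  moreover have "u \<in> verts G" "v \<in> verts G"
    using finite_multigraph.ends_in_verts[OF assms(1,2)] uv by auto
  ultimately show ?thesis
    using uv that by blast
qed

lemma vertex_degree_spanning_subgraph:
  "vertex_degree (spanning_subgraph G s) i = (\<Sum>a\<in>s. count (ends G a) i)"
  by (simp add: vertex_degree_def spanning_subgraph_def)

definition state_weight :: "('v, 'e) multigraph \<Rightarrow> 'e set \<Rightarrow> int poly poly" where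
  "state_weight G s =
     beta ^ card s * (\<Prod>i\<in>verts G. [:f_poly (vertex_degree (spanning_subgraph G s) i):])"

lemma theta_eq_sum_state_weight: "theta G = (\<Sum>s\<in>Pow (edges G). state_weight G s)"
  by (simp add: theta_def state_weight_def)

lemma state_weight_delete_edge: "state_weight (delete_edge G e) s = state_weight G s"
  by (simp add: state_weight_def delete_edge_def spanning_subgraph_def)

text \<open>
  Away from \<open>u\<close> and \<open>v\<close>, contraction only renames a vertex \<open>w\<close> to \<open>{w}\<close>. The ends of an
  edge parallel to \<open>e\<close> are both sent to the merged vertex, so that edge contributes 2 to its
  degree, just as it does to the sum of the degrees of \<open>u\<close> and \<open>v\<close>.
\<close>

lemma
  assumes e: "ends G e = {#u, v#}" and uv: "u \<noteq> v"
  shows vertex_degree_contract_edge_merged: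
      "vertex_degree (spanning_subgraph (contract_edge G e) s) {u, v} =
         vertex_degree (spanning_subgraph G s) u + vertex_degree (spanning_subgraph G s) v"
    and vertex_degree_contract_edge_other:
      "w \<notin> {u, v} \<Longrightarrow> vertex_degree (spanning_subgraph (contract_edge G e) s) {w} =
         vertex_degree (spanning_subgraph G s) w"
proof -
  have "merge_class G e x = {u, v} \<longleftrightarrow> x = u \<or> x = v" for x
    using e uv by (auto simp: merge_class_def)
  then show "vertex_degree (spanning_subgraph (contract_edge G e) s) {u, v} =
         vertex_degree (spanning_subgraph G s) u + vertex_degree (spanning_subgraph G s) v"
    by (simp add: vertex_degree_spanning_subgraph contract_edge_def
        count_image_mset_pair[OF uv] sum.distrib)
next
  assume "w \<notin> {u, v}"
  then have "merge_class G e x = {w} \<longleftrightarrow> x = w" for x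
    using e uv by (auto simp: merge_class_def)
  then show "vertex_degree (spanning_subgraph (contract_edge G e) s) {w} =
         vertex_degree (spanning_subgraph G s) w"
    by (simp add: vertex_degree_spanning_subgraph contract_edge_def count_image_mset_singleton)
qed

lemma verts_contract_edge:
  assumes "ends G e = {#u, v#}" "u \<in> verts G" "v \<in> verts G"
  shows "verts (contract_edge G e) = insert {u, v} ((\<lambda>w. {w}) ` (verts G - {u, v}))"
  using assms by (auto simp: contract_edge_def merge_class_def)

text \<open>
  All three weights have \<open>beta ^ card s\<close> and the factors of the vertices other than \<open>u\<close> and
  \<open>v\<close> in common. With \<open>state_weight G s\<close> cancelled, the cofactors on the two sides differ by
  \<open>beta\<close> times the addition law of \<open>f_poly\<close> at the degrees of \<open>u\<close> and \<open>v\<close> in \<open>s\<close>.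
\<close>

lemma edge_pair_weights:
  assumes "finite (verts G)" "finite s" "e \<notin> s"
    and e: "ends G e = {#u, v#}" and uv: "u \<noteq> v" "u \<in> verts G" "v \<in> verts G"
  shows "state_weight G s + state_weight G (insert e s) =
    (1 - beta) * state_weight G s + beta * state_weight (contract_edge G e) s"
proof -
  define d where "d i = vertex_degree (spanning_subgraph G s) i" for i
  define R where "R = (\<Prod>i\<in>verts G - {u, v}. [:f_poly (d i):])"
  have split: "(\<Prod>i\<in>verts G. g i) = g u * g v * (\<Prod>i\<in>verts G - {u, v}. g i)"
    for g :: "'a \<Rightarrow> int poly poly"
    using assms(1) uv by (simp add: prod.subset_diff[of "{u, v}" "verts G"] mult.commute)
  \<comment> \<open>The factors stay products of constant polynomials: multiplying them out coefficientwise
    would hide the common factor \<open>R\<close>.\<close>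
  have without: "state_weight G s = beta ^ card s * ([:f_poly (d u):] * [:f_poly (d v):] * R)"
    by (simp add: state_weight_def split d_def R_def del: mult_pCons_left mult_pCons_right)
  have degree_insert: "vertex_degree (spanning_subgraph G (insert e s)) i =
      (if i \<in> {u, v} then Suc (d i) else d i)" for i
    using assms(2,3) e uv by (auto simp: d_def vertex_degree_spanning_subgraph)
  have "state_weight G (insert e s) =
      beta ^ Suc (card s) * ([:f_poly (Suc (d u)):] * [:f_poly (Suc (d v)):] * R)"
    using assms(2,3)
    by (simp add: state_weight_def split degree_insert R_def
        del: mult_pCons_left mult_pCons_right)
  moreover have "state_weight (contract_edge G e) s =
      beta ^ card s * ([:f_poly (d u + d v):] * R)"
  proof -
    have "{u, v} \<notin> (\<lambda>w. {w}) ` (verts G - {u, v})"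
      by auto
    then have "(\<Prod>i\<in>verts (contract_edge G e).
          [:f_poly (vertex_degree (spanning_subgraph (contract_edge G e) s) i):]) =
        [:f_poly (d u + d v):] * R"
      using assms(1)
      by (simp add: verts_contract_edge[OF e uv(2,3)] prod.reindex
          vertex_degree_contract_edge_merged[OF e uv(1)]
          vertex_degree_contract_edge_other[OF e uv(1)] d_def R_def
          del: mult_pCons_left mult_pCons_right)
    then show ?thesis
      by (simp add: state_weight_def)
  qed
  moreover have "[:f_poly (d u + d v):] = [:f_poly (d u):] * [:f_poly (d v):] +
      [:f_poly (Suc (d u)):] * [:f_poly (Suc (d v)):]"
    by (simp add: f_poly_add)
  ultimately show ?thesis
    unfolding without by (simp only: power_Suc algebra_simps)
qed

theorem theorem1:
  fixes G :: "('v, 'e) multigraph" and e :: 'e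
  assumes "finite_multigraph G"
    and "e \<in> edges G"
    and "\<not> is_loop G e"
  shows "theta G = (1 - beta) * theta (delete_edge G e) + beta * theta (contract_edge G e)"
proof -
  obtain u v where uv: "ends G e = {#u, v#}" "u \<noteq> v" "u \<in> verts G" "v \<in> verts G"
    using ends_of_nonloop[OF assms] .
  have fin: "finite (verts G)" "finite (edges G)"
    using assms(1) by (simp_all add: finite_multigraph_def)
  define P where "P = Pow (edges G - {e})"
  have finP: "finite P"
    using fin(2) by (simp add: P_def)
  have "Pow (edges G) = P \<union> insert e ` P"
    using assms(2) Pow_insert[of e "edges G - {e}"] by (simp add: P_def insert_absorb)
  moreover have "P \<inter> insert e ` P = {}"
    by (auto simp: P_def)
  moreover have "inj_on (insert e) P"
    by (auto simp: P_def inj_on_def)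
  ultimately have "theta G = (\<Sum>s\<in>P. state_weight G s + state_weight G (insert e s))"
    using finP
    by (simp add: theta_eq_sum_state_weight sum.union_disjoint sum.reindex sum.distrib)
  also have "\<dots> = (\<Sum>s\<in>P. (1 - beta) * state_weight G s +
      beta * state_weight (contract_edge G e) s)"
    using fin
    by (intro sum.cong refl edge_pair_weights[OF _ _ _ uv])
      (auto simp: P_def intro: finite_subset)
  also have "\<dots> = (1 - beta) * theta (delete_edge G e) + beta * theta (contract_edge G e)"
  proof -
    have "edges (delete_edge G e) = edges G - {e}" "edges (contract_edge G e) = edges G - {e}"
      by (simp_all add: delete_edge_def spanning_subgraph_def contract_edge_def)
    then show ?thesis
      by (simp add: theta_eq_sum_state_weight state_weight_delete_edge P_def
          sum.distrib sum_distrib_left)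
  qed
  finally show ?thesis .
qed

end
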